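(* Let $m\ge7$, and let $G$ be an irreducible limited $m\times4$ configuration with $R$ displayed squares. For a degree-one row $u$ (a row containing exactly one one-edge), let $h_u$ be the number of holes (unoccupied cells) in that row and let $p_u$ be the number of two-edges whose two halves both lie in that row. Then $$R-4+h_u+p_u\le z_2(m-1,4).$$ In particular, $z_2(m,4)\le z_2(m-1,4)+4$ for every $m\ge 7$.
   Context: Fix $m,n\ge1$. Identify the cell $(i,j)$ (row $i$, column $j$) of the $m\times n$ grid with the monomial $u_{ij}=x_iy_j$ in real variables $x_i,y_j$. A bilinear form is a real linear combination of the $u_{ij}$. If $P$ is a sum of squares of real bilinear forms, $\mathrm{SOS}(P)$ is the least number of squares in such a representation. A one-edge is a single cell; a two-edge is an unordered pair of two distinct cells, its halves (possibly in a common row or column). An augmented configuration $G$ consists of a set $E_1$ of one-edges and a set $E_2$ of two-edges; it is simple if distinct selected edges have disjoint supports (sets of cells). A cell is occupied if it lies in the support of a selected edge. Put $P_G=\sum_{(i,j)\in E_1}u_{ij}^2+\sum_{\{(i,j),(k,\ell)\}\in E_2}(u_{ij}+u_{k\ell})^2$ and $R(G)=|E_1|+|E_2|$ (number of displayed squares). $G$ is irreducible if $\mathrm{SOS}(P_G)=R(G)$. $z(m,n)$ is the maximum number of edges of a $C_4$-free bipartite graph with parts $[m]$ (rows) and $[n]$ (columns). $G$ is limited if it is simple, $E_1$ is $C_4$-free as a bipartite graph, and $|E_1|=z(m,n)$. $z_2(m,n)$ is the maximum of $R(G)$ over irreducible limited $m\times n$ configurations. (For $m\ge6$ one has $z(m,4)=m+6$,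 and every $C_4$-free $E_1$ with $m+6$ cells has six rows of degree two and $m-6$ rows of degree one.) *)

theory Defs
  imports Complex_Main
begin

type_synonym cell = "nat \<times> nat"

definition grid :: "nat \<Rightarrow> nat \<Rightarrow> cell set" where
  "grid m n = {1..m} \<times> {1..n}"

definition row_cells :: "nat \<Rightarrow> nat \<Rightarrow> cell set" where
  "row_cells n i = {i} \<times> {1..n}"

(* A real polynomial in the variables x_i, y_j is represented by the polynomial function
   it induces. This loses nothing, since the reals are infinite: two real polynomials
   are equal iff they take the same values. *)
type_synonym xy_fun = "(nat \<Rightarrow> real) \<Rightarrow> (nat \<Rightarrow> real) \<Rightarrow> real"

definition cell_mono :: "cell \<Rightarrow> xy_fun" where
  "cell_mono c x y = x (fst c) * y (snd c)"

definition bilinear_form :: "nat \<Rightarrow> nat \<Rightarrow> xy_fun \<Rightarrow> bool" where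
  "bilinear_form m n f \<longleftrightarrow>
     (\<exists>a :: cell \<Rightarrow> real. \<forall>x y. f x y = (\<Sum>c\<in>grid m n. a c * cell_mono c x y))"

definition sum_of_squares :: "nat \<Rightarrow> nat \<Rightarrow> nat \<Rightarrow> xy_fun \<Rightarrow> bool" where
  "sum_of_squares m n r P \<longleftrightarrow>
     (\<exists>f :: nat \<Rightarrow> xy_fun. (\<forall>k<r. bilinear_form m n (f k)) \<and>
        (\<forall>x y. P x y = (\<Sum>k<r. (f k x y)\<^sup>2)))"

(* Meaningful only if P is a sum of squares of bilinear forms. *)
definition SOS :: "nat \<Rightarrow> nat \<Rightarrow> xy_fun \<Rightarrow> nat" where
  "SOS m n P = (LEAST r. sum_of_squares m n r P)"

(* A pair (E_1, E_2): a one-edge is a cell, a two-edge is a set of two distinct cells. *)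
type_synonym config = "cell set \<times> cell set set"

abbreviation one_edges :: "config \<Rightarrow> cell set" where
  "one_edges G \<equiv> fst G"

abbreviation two_edges :: "config \<Rightarrow> cell set set" where
  "two_edges G \<equiv> snd G"

definition augmented_config :: "nat \<Rightarrow> nat \<Rightarrow> config \<Rightarrow> bool" where
  "augmented_config m n G \<longleftrightarrow>
     one_edges G \<subseteq> grid m n \<and> (\<forall>e\<in>two_edges G. e \<subseteq> grid m n \<and> card e = 2)"

(* Distinct selected edges have distinct supports (a one-edge has one cell, a two-edge two),
   so the set of supports represents the selected edges faithfully. *)
definition supports :: "config \<Rightarrow> cell set set" where
  "supports G = (\<lambda>c. {c}) ` one_edges G \<union> two_edges G"

definition simple_config :: "config \<Rightarrow> bool" where
  "simple_config G \<longleftrightarrow> pairwise disjnt (supports G)"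

definition occupied :: "config \<Rightarrow> cell set" where
  "occupied G = \<Union> (supports G)"

definition config_poly :: "config \<Rightarrow> xy_fun" where
  "config_poly G x y =
     (\<Sum>c\<in>one_edges G. (cell_mono c x y)\<^sup>2) +
     (\<Sum>e\<in>two_edges G. (\<Sum>c\<in>e. cell_mono c x y)\<^sup>2)"

definition num_squares :: "config \<Rightarrow> nat" where
  "num_squares G = card (one_edges G) + card (two_edges G)"

definition irreducible_config :: "nat \<Rightarrow> nat \<Rightarrow> config \<Rightarrow> bool" where
  "irreducible_config m n G \<longleftrightarrow> SOS m n (config_poly G) = num_squares G"

(* A set of cells is the edge set of a bipartite graph between rows and columns;
   a 4-cycle of it runs through row i, column j, row k, column l. *)
definition C4_free :: "cell set \<Rightarrow> bool" where
  "C4_free B \<longleftrightarrow>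
     \<not> (\<exists>i j k l. i \<noteq> k \<and> j \<noteq> l \<and> (i, j) \<in> B \<and> (k, j) \<in> B \<and> (k, l) \<in> B \<and> (i, l) \<in> B)"

definition z :: "nat \<Rightarrow> nat \<Rightarrow> nat" where
  "z m n = Max {card B |B. B \<subseteq> grid m n \<and> C4_free B}"

definition limited_config :: "nat \<Rightarrow> nat \<Rightarrow> config \<Rightarrow> bool" where
  "limited_config m n G \<longleftrightarrow>
     augmented_config m n G \<and> simple_config G \<and>
     C4_free (one_edges G) \<and> card (one_edges G) = z m n"

(* For m, n >= 1 the maximum is over a nonempty finite set: a C4-free E_1 of size z m n
   without two-edges is irreducible. *)
definition z2 :: "nat \<Rightarrow> nat \<Rightarrow> nat" where
  "z2 m n = Max {num_squares G |G. limited_config m n G \<and> irreducible_config m n G}"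

definition degree_one_row :: "nat \<Rightarrow> nat \<Rightarrow> config \<Rightarrow> nat \<Rightarrow> bool" where
  "degree_one_row m n G u \<longleftrightarrow> u \<in> {1..m} \<and> card (one_edges G \<inter> row_cells n u) = 1"

definition row_holes :: "nat \<Rightarrow> config \<Rightarrow> nat \<Rightarrow> nat" where
  "row_holes n G u = card (row_cells n u - occupied G)"

definition row_two_edges :: "nat \<Rightarrow> config \<Rightarrow> nat \<Rightarrow> nat" where
  "row_two_edges n G u = card {e \<in> two_edges G. e \<subseteq> row_cells n u}"

end

theory Submission imports Defs begin

text \<open>
  Delete row \<open>u\<close> together with every selected edge meeting it, and renumber the rows below it.
  The displayed square of a deleted edge can be added back to any sum of squares representing
  the smaller polynomial, so irreducibility survives. Counting the \<open>n\<close> cells of the row, each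
  edge meeting it uses one cell, except that a two-edge inside the row uses two; hence
  \<open>n - h\<^sub>u - p\<^sub>u\<close> edges are lost. If the row has degree one, the smaller configuration is again
  limited because \<open>z m 4 = m + 6\<close> for \<open>m \<ge> 6\<close>: the column pairs covered by the rows of a
  \<open>C\<^sub>4\<close>-free set are distinct, and there are only six pairs.
\<close>

section \<open>Sums of squares\<close>

lemma finite_grid [simp]: "finite (grid m n)"
  by (simp add: grid_def)

lemma sum_of_squares_add:
  assumes "sum_of_squares m n r P" "sum_of_squares m n s Q"
  shows "sum_of_squares m n (r + s) (\<lambda>x y. P x y + Q x y)"
proof -
  obtain f g where f: "\<forall>k<r. bilinear_form m n (f k)" "\<forall>x y. P x y = (\<Sum>k<r. (f k x y)\<^sup>2)"
    and g: "\<forall>k<s. bilinear_form m n (g k)" "\<forall>x y. Q x y = (\<Sum>k<s. (g k x y)\<^sup>2)"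
    using assms unfolding sum_of_squares_def by blast
  define h where "h k = (if k < r then f k else g (k - r))" for k
  have "(\<Sum>k<r + s. (h k x y)\<^sup>2) = P x y + Q x y" for x y
  proof -
    have "(\<Sum>k<r + s. (h k x y)\<^sup>2) = (\<Sum>k<r. (h k x y)\<^sup>2) + (\<Sum>k<s. (h (r + k) x y)\<^sup>2)"
      by (induction s) simp_all
    then show ?thesis by (simp add: h_def f(2) g(2))
  qed
  moreover have "\<forall>k<r + s. bilinear_form m n (h k)"
    using f(1) g(1) by (auto simp: h_def)
  ultimately show ?thesis unfolding sum_of_squares_def by metis
qed

lemma bilinear_form_sum_cells:
  assumes "S \<subseteq> grid m n"
  shows "bilinear_form m n (\<lambda>x y. \<Sum>c\<in>S. cell_mono c x y)"
  unfolding bilinear_form_def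
proof (intro exI allI)
  fix x y
  show "(\<Sum>c\<in>S. cell_mono c x y) = (\<Sum>c\<in>grid m n. of_bool (c \<in> S) * cell_mono c x y)"
    by (rule sum.mono_neutral_cong_left) (use assms in auto)
qed

lemma sum_of_squares_sum_cells:
  assumes "finite A" "\<Union>A \<subseteq> grid m n"
  shows "sum_of_squares m n (card A) (\<lambda>x y. \<Sum>S\<in>A. (\<Sum>c\<in>S. cell_mono c x y)\<^sup>2)"
proof -
  obtain h where h: "bij_betw h {..<card A} A"
    using ex_bij_betw_nat_finite[OF assms(1)] by (auto simp: lessThan_atLeast0)
  have "(\<Sum>S\<in>A. (\<Sum>c\<in>S. cell_mono c x y)\<^sup>2) = (\<Sum>k<card A. (\<Sum>c\<in>h k. cell_mono c x y)\<^sup>2)" for x y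
    using sum.reindex_bij_betw[OF h, of "\<lambda>S. (\<Sum>c\<in>S. cell_mono c x y)\<^sup>2"] by simp
  moreover have "bilinear_form m n (\<lambda>x y. \<Sum>c\<in>h k. cell_mono c x y)" if "k < card A" for k
    using that assms(2) bij_betwE[OF h] by (intro bilinear_form_sum_cells) blast
  ultimately show ?thesis
    unfolding sum_of_squares_def by (intro exI[of _ "\<lambda>k x y. \<Sum>c\<in>h k. cell_mono c x y"]) simp
qed

section \<open>Configurations as families of supports\<close>

lemma sum_supports:
  assumes "augmented_config m n G"
  shows "(\<Sum>S\<in>supports G. g S) = (\<Sum>c\<in>one_edges G. g {c}) + (\<Sum>e\<in>two_edges G. g e)"
proof -
  have "one_edges G \<subseteq> grid m n" "two_edges G \<subseteq> Pow (grid m n)"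
    using assms unfolding augmented_config_def by auto
  then have fin: "finite (one_edges G)" "finite (two_edges G)"
    by (auto dest: finite_subset)
  \<comment> \<open>Supports of one-edges have one cell and two-edges have two, so the two families
    cannot overlap and the sum over their union splits.\<close>
  have "card e = 2" if "e \<in> two_edges G" for e
    using assms that unfolding augmented_config_def by blast
  then have "(\<lambda>c. {c}) ` one_edges G \<inter> two_edges G = {}"
    by force
  then show ?thesis
    using fin by (simp add: supports_def sum.union_disjoint sum.reindex)
qed

lemma supports_finite:
  assumes "augmented_config m n G"
  shows "finite (supports G)" "\<Union>(supports G) \<subseteq> grid m n"
proof -
  show *: "\<Union>(supports G) \<subseteq> grid m n"
    using assms unfolding augmented_config_def supports_def by auto
  then have "supports G \<subseteq> Pow (grid m n)" by blast
  then show "finite (supports G)"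
    by (rule finite_subset) simp
qed

lemma num_squares_eq_card_supports:
  "augmented_config m n G \<Longrightarrow> num_squares G = card (supports G)"
  using sum_supports[of m n G "\<lambda>_. 1::nat"] by (simp add: num_squares_def)

text \<open>Writing the polynomial as one sum over supports lets row deletion treat one-edges and
  two-edges alike.\<close>

lemma config_poly_eq_sum_supports:
  "augmented_config m n G \<Longrightarrow>
    config_poly G x y = (\<Sum>S\<in>supports G. (\<Sum>c\<in>S. cell_mono c x y)\<^sup>2)"
  by (simp add: sum_supports config_poly_def)

lemma sum_of_squares_config_poly:
  assumes "augmented_config m n G"
  shows "sum_of_squares m n (num_squares G) (config_poly G)"
proof -
  have "config_poly G = (\<lambda>x y. \<Sum>S\<in>supports G. (\<Sum>c\<in>S. cell_mono c x y)\<^sup>2)"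
    using config_poly_eq_sum_supports[OF assms] by blast
  then show ?thesis
    using sum_of_squares_sum_cells[OF supports_finite[OF assms]]
    by (simp add: num_squares_eq_card_supports[OF assms])
qed

section \<open>Deleting a row\<close>

text \<open>The increasing map whose range misses exactly \<open>u\<close>: rows of the smaller grid
  are embedded in the larger one instead of the larger one being renumbered.\<close>

definition skip_row :: "nat \<Rightarrow> nat \<Rightarrow> nat" where
  "skip_row u i = (if i < u then i else Suc i)"

definition skip_cell :: "nat \<Rightarrow> cell \<Rightarrow> cell" where
  "skip_cell u c = (skip_row u (fst c), snd c)"

text \<open>Pulling back along the embedding removes a two-edge as soon as one half lies in row
  \<open>u\<close>, because no image under \<open>skip_cell u\<close> contains a cell of that
  row.\<close>

definition delete_row :: "nat \<Rightarrow> config \<Rightarrow> config" where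
  "delete_row u G = (skip_cell u -` one_edges G, {e. skip_cell u ` e \<in> two_edges G})"

lemma skip_row_eq_iff [simp]: "skip_row u i = skip_row u k \<longleftrightarrow> i = k"
  by (auto simp: skip_row_def)

lemma inj_skip_cell: "inj (skip_cell u)"
  by (auto simp: inj_def skip_cell_def prod_eq_iff)

lemma range_skip_cell: "range (skip_cell u) = {c. fst c \<noteq> u}"
proof -
  have "c \<in> range (skip_cell u)" if "fst c \<noteq> u" for c
    by (rule image_eqI[of _ _ "(if fst c < u then fst c else fst c - 1, snd c)"])
      (use that in \<open>auto simp: skip_cell_def skip_row_def prod_eq_iff\<close>)
  then show ?thesis by (auto simp: skip_cell_def skip_row_def split: if_splits)
qed

lemma skip_cell_in_grid_iff:
  "u \<in> {1..m} \<Longrightarrow> skip_cell u c \<in> grid m n \<longleftrightarrow> c \<in> grid (m - 1) n"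
  by (cases c) (auto simp: skip_cell_def skip_row_def grid_def)

lemma in_range_image_skip_cell:
  assumes "\<forall>c\<in>S. fst c \<noteq> u"
  shows "skip_cell u ` (skip_cell u -` S) = S"
  using assms range_skip_cell[of u] by (auto simp: image_vimage_eq)

text \<open>Since \<open>skip_cell u\<close> is injective, only a singleton has a singleton image;
  hence the pullback of two-edges also describes the pullback of one-edges.\<close>

lemma supports_delete_row:
  "supports (delete_row u G) = {S. skip_cell u ` S \<in> supports G}"
proof (intro set_eqI)
  fix S
  have "(\<exists>c. skip_cell u ` S = {c} \<and> c \<in> one_edges G) \<longleftrightarrow>
        (\<exists>c. S = {c} \<and> skip_cell u c \<in> one_edges G)" (is "?L \<longleftrightarrow> ?R")
  proof
    assume ?L
    then obtain c where c: "skip_cell u ` S = {c}" "c \<in> one_edges G" by blast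
    then obtain d where d: "d \<in> S" "skip_cell u d = c" by blast
    have "S = {d}"
    proof -
      have "e = d" if "e \<in> S" for e
        using that c(1) d inj_skip_cell[of u] by (metis imageI injD singletonD)
      then show ?thesis using d by blast
    qed
    then show ?R using c d by blast
  next
    assume ?R
    then obtain c where "S = {c}" "skip_cell u c \<in> one_edges G" by blast
    then show ?L by (intro exI[of _ "skip_cell u c"]) simp
  qed
  then show "S \<in> supports (delete_row u G) \<longleftrightarrow> S \<in> {S. skip_cell u ` S \<in> supports G}"
    by (auto simp: supports_def delete_row_def)
qed

text \<open>Identifies the surviving edges inside the original grid: a support avoiding row
  \<open>u\<close> is the image of its own preimage.\<close>

lemma image_supports_delete_row:
  "image (skip_cell u) ` supports (delete_row u G) = {S \<in> supports G. \<forall>c\<in>S. fst c \<noteq> u}"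
proof -
  have "S \<in> image (skip_cell u) ` supports (delete_row u G)"
    if "S \<in> supports G" "\<forall>c\<in>S. fst c \<noteq> u" for S
    using that in_range_image_skip_cell[OF that(2)] supports_delete_row[of u G]
    by (intro image_eqI[of _ _ "skip_cell u -` S"]) auto
  moreover have "image (skip_cell u) ` supports (delete_row u G)
      \<subseteq> {S \<in> supports G. \<forall>c\<in>S. fst c \<noteq> u}"
    using range_skip_cell[of u] unfolding supports_delete_row by blast
  ultimately show ?thesis by blast
qed

section \<open>Properties inherited by the smaller configuration\<close>

lemma augmented_config_delete_row:
  assumes "augmented_config m n G" "u \<in> {1..m}"
  shows "augmented_config (m - 1) n (delete_row u G)"
proof -
  have "e \<subseteq> grid (m - 1) n \<longleftrightarrow> skip_cell u ` e \<subseteq> grid m n" for e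
    using skip_cell_in_grid_iff[OF assms(2)] by blast
  moreover have "card e = card (skip_cell u ` e)" for e
    by (rule sym) (intro card_image inj_on_subset[OF inj_skip_cell] subset_UNIV)
  moreover have "c \<in> grid (m - 1) n" if "c \<in> one_edges (delete_row u G)" for c
  proof -
    have "skip_cell u c \<in> grid m n"
      using that assms(1) by (cases "skip_cell u c") (auto simp: augmented_config_def delete_row_def)
    then show ?thesis by (simp only: skip_cell_in_grid_iff[OF assms(2)])
  qed
  ultimately show ?thesis
    using assms(1) by (auto simp: augmented_config_def delete_row_def)
qed

lemma simple_config_delete_row:
  assumes "simple_config G"
  shows "simple_config (delete_row u G)"
  unfolding simple_config_def
proof (rule pairwiseI)
  fix S T assume "S \<in> supports (delete_row u G)" "T \<in> supports (delete_row u G)" "S \<noteq> T"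
  then have "skip_cell u ` S \<in> supports G" "skip_cell u ` T \<in> supports G"
    "skip_cell u ` S \<noteq> skip_cell u ` T"
    by (simp_all add: supports_delete_row inj_image_eq_iff[OF inj_skip_cell])
  then have "disjnt (skip_cell u ` S) (skip_cell u ` T)"
    using assms unfolding simple_config_def by (rule pairwiseD[rotated])
  then show "disjnt S T" by (auto simp: disjnt_def)
qed

lemma C4_free_delete_row:
  assumes "C4_free (one_edges G)"
  shows "C4_free (one_edges (delete_row u G))"
  unfolding C4_free_def
proof (rule notI, elim exE conjE)
  fix i j k l
  assume "i \<noteq> k" "j \<noteq> l" and "(i, j) \<in> one_edges (delete_row u G)"
    "(k, j) \<in> one_edges (delete_row u G)" "(k, l) \<in> one_edges (delete_row u G)"
    "(i, l) \<in> one_edges (delete_row u G)"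
  then have "skip_row u i \<noteq> skip_row u k" "(skip_row u i, j) \<in> one_edges G"
    "(skip_row u k, j) \<in> one_edges G" "(skip_row u k, l) \<in> one_edges G"
    "(skip_row u i, l) \<in> one_edges G"
    by (simp_all add: delete_row_def skip_cell_def)
  then show False using assms \<open>j \<noteq> l\<close> unfolding C4_free_def by blast
qed

section \<open>Counting what the deletion removes\<close>

lemma card_one_edges_delete_row:
  assumes "one_edges G \<subseteq> grid m n"
  shows "card (one_edges (delete_row u G)) + card (one_edges G \<inter> row_cells n u)
    = card (one_edges G)"
proof -
  let ?E = "one_edges G"
  have fin: "finite ?E" using assms by (rule finite_subset) simp
  have "card (skip_cell u -` ?E) = card (?E \<inter> {c. fst c \<noteq> u})"
    using card_image[OF inj_on_subset[OF inj_skip_cell subset_UNIV], of u "skip_cell u -` ?E"]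
    by (simp add: image_vimage_eq range_skip_cell)
  moreover have "?E \<inter> row_cells n u = ?E - {c. fst c \<noteq> u}"
    using assms by (auto simp: row_cells_def grid_def)
  ultimately show ?thesis
    using card_Int_Diff[OF fin] by (simp add: delete_row_def)
qed

lemma num_squares_delete_row:
  assumes "augmented_config m n G" "u \<in> {1..m}"
  shows "num_squares (delete_row u G) + card {S \<in> supports G. \<exists>c\<in>S. fst c = u} = num_squares G"
proof -
  have "card (supports (delete_row u G)) = card {S \<in> supports G. \<forall>c\<in>S. fst c \<noteq> u}"
    using card_image[of "image (skip_cell u)" "supports (delete_row u G)"]
    by (simp add: image_supports_delete_row inj_on_def inj_image_eq_iff[OF inj_skip_cell])
  moreover have "{S \<in> supports G. \<exists>c\<in>S. fst c = u} = supports G - {S \<in> supports G. \<forall>c\<in>S. fst c \<noteq> u}"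
    by auto
  ultimately show ?thesis
    using supports_finite[OF assms(1)] augmented_config_delete_row[OF assms] assms(1)
      card_Int_Diff[of "supports G" "{S \<in> supports G. \<forall>c\<in>S. fst c \<noteq> u}"]
    by (simp add: num_squares_eq_card_supports Int_absorb1)
qed

lemma card_edges_meeting_row:
  assumes aug: "augmented_config m n G" and simple: "simple_config G" and "u \<in> {1..m}"
  shows "card {S \<in> supports G. \<exists>c\<in>S. fst c = u} + row_holes n G u + row_two_edges n G u = n"
proof -
  let ?W = "row_cells n u"
  have fin: "finite (supports G)" and sub: "\<Union>(supports G) \<subseteq> grid m n"
    using supports_finite[OF aug] by auto
  have row: "c \<in> ?W \<longleftrightarrow> fst c = u" if "S \<in> supports G" "c \<in> S" for S c
  proof -
    have "c \<in> grid m n" using sub that by blast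
    then show ?thesis by (cases c) (auto simp: row_cells_def grid_def)
  qed
  have W: "finite ?W" "card ?W = n" by (auto simp: row_cells_def card_cartesian_product)
  \<comment> \<open>An edge that meets the row uses one of its cells, and a second one exactly when
    it is a two-edge lying inside the row.\<close>
  have cell: "card (S \<inter> ?W) =
      of_bool (\<exists>c\<in>S. fst c = u) + of_bool (S \<in> two_edges G \<and> S \<subseteq> ?W)"
    if S: "S \<in> supports G" for S
  proof -
    have 1: "S \<inter> ?W = {c \<in> S. fst c = u}" and 2: "S \<subseteq> ?W \<longleftrightarrow> (\<forall>c\<in>S. fst c = u)"
      using row[OF S] by blast+
    show ?thesis
    proof (cases "S \<in> two_edges G")
      case True
      then have "card S = 2" using aug by (simp add: augmented_config_def)
      then obtain a b where ab: "S = {a, b}" "a \<noteq> b" by (meson card_2_iff)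
      have "{c \<in> S. fst c = u} = (if fst a = u then {a} else {}) \<union> (if fst b = u then {b} else {})"
        unfolding ab(1) by auto
      then show ?thesis
        unfolding 1 2 using True ab by (cases "fst a = u"; cases "fst b = u") simp_all
    next
      case False
      then obtain a where a: "S = {a}" using S unfolding supports_def by blast
      have "{c \<in> S. fst c = u} = (if fst a = u then {a} else {})"
        unfolding a by auto
      then show ?thesis unfolding 1 2 using False a by simp
    qed
  qed
  have "card (occupied G \<inter> ?W) = card (\<Union>S\<in>supports G. S \<inter> ?W)"
    by (simp only: occupied_def Int_Union2)
  also have "\<dots> = (\<Sum>S\<in>supports G. card (S \<inter> ?W))"
  \<comment> \<open>Simplicity makes the traces of distinct supports on the row disjoint; traces
    that are empty contribute zero to the sum.\<close>
  proof (rule card_UN_disjoint[OF fin])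
    show "\<forall>S\<in>supports G. \<forall>T\<in>supports G. S \<noteq> T \<longrightarrow> (S \<inter> ?W) \<inter> (T \<inter> ?W) = {}"
      using simple unfolding simple_config_def pairwise_def disjnt_def by blast
  qed (simp add: W(1))
  also have "\<dots> = card {S \<in> supports G. \<exists>c\<in>S. fst c = u}
      + card {S \<in> supports G. S \<in> two_edges G \<and> S \<subseteq> ?W}"
    using fin by (simp add: cell sum.distrib Collect_conj_eq cong: sum.cong)
  also have "{S \<in> supports G. S \<in> two_edges G \<and> S \<subseteq> ?W} = {e \<in> two_edges G. e \<subseteq> ?W}"
    by (auto simp: supports_def)
  finally show ?thesis
    using card_Int_Diff[OF W(1), of "occupied G"] W(2)
    by (simp add: row_holes_def row_two_edges_def Int_commute)
qed

section \<open>Transfer of sums of squares to the larger grid\<close>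

lemma sum_of_squares_skip_row:
  assumes "sum_of_squares (m - 1) n r P" "u \<in> {1..m}"
  shows "sum_of_squares m n r (\<lambda>x y. P (\<lambda>i. x (skip_row u i)) y)"
proof -
  have "bilinear_form m n (\<lambda>x y. f (\<lambda>i. x (skip_row u i)) y)" if "bilinear_form (m - 1) n f" for f
  proof -
    from that have "\<exists>a. \<forall>x y. f x y = (\<Sum>c\<in>grid (m - 1) n. a c * cell_mono c x y)"
      unfolding bilinear_form_def .
    then obtain a where a: "\<forall>x y. f x y = (\<Sum>c\<in>grid (m - 1) n. a c * cell_mono c x y)" ..
    \<comment> \<open>Coefficients move along the embedding; cells of row \<open>u\<close> lie
      outside its range and get coefficient 0.\<close>
    define b where
      "b c = of_bool (c \<in> range (skip_cell u)) * a (inv (skip_cell u) c)" for c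
    have "(\<Sum>c\<in>grid (m - 1) n. a c * cell_mono c (\<lambda>i. x (skip_row u i)) y) =
        (\<Sum>c\<in>grid m n. b c * cell_mono c x y)" for x y
    proof -
      have "(\<Sum>c\<in>grid (m - 1) n. a c * cell_mono c (\<lambda>i. x (skip_row u i)) y) =
          (\<Sum>c\<in>grid (m - 1) n. b (skip_cell u c) * cell_mono (skip_cell u c) x y)"
      proof (rule sum.cong[OF refl])
        fix c
        have "b (skip_cell u c) = a c"
          by (simp add: b_def inv_f_f[OF inj_skip_cell])
        then show "a c * cell_mono c (\<lambda>i. x (skip_row u i)) y
            = b (skip_cell u c) * cell_mono (skip_cell u c) x y"
          by (simp add: cell_mono_def skip_cell_def)
      qed
      also have "\<dots> = (\<Sum>c\<in>skip_cell u ` grid (m - 1) n. b c * cell_mono c x y)"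
        by (simp add: sum.reindex[OF inj_on_subset[OF inj_skip_cell subset_UNIV]])
      also have "\<dots> = (\<Sum>c\<in>grid m n. b c * cell_mono c x y)"
      proof (rule sum.mono_neutral_left)
        show "skip_cell u ` grid (m - 1) n \<subseteq> grid m n"
          using skip_cell_in_grid_iff[OF assms(2)] by blast
        have "b c = 0" if "c \<in> grid m n - skip_cell u ` grid (m - 1) n" for c
        proof -
          have "c \<notin> range (skip_cell u)"
            using that skip_cell_in_grid_iff[OF assms(2)] by blast
          then show ?thesis by (simp add: b_def)
        qed
        then show "\<forall>c\<in>grid m n - skip_cell u ` grid (m - 1) n. b c * cell_mono c x y = 0"
          by simp
      qed simp
      finally show ?thesis .
    qed
    then show ?thesis unfolding bilinear_form_def a[rule_format] by (intro exI[of _ b] allI)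
  qed
  moreover obtain f where f: "\<forall>k<r. bilinear_form (m - 1) n (f k)"
    "\<forall>x y. P x y = (\<Sum>k<r. (f k x y)\<^sup>2)"
    using assms(1) unfolding sum_of_squares_def by blast
  ultimately show ?thesis unfolding sum_of_squares_def
    by (intro exI[of _ "\<lambda>k x y. f k (\<lambda>i. x (skip_row u i)) y"]) simp
qed

text \<open>After the substitution of variables, the smaller polynomial is the sum of the squares of
  the supports avoiding row \<open>u\<close>; the remaining supports supply the second
  summand.\<close>

lemma config_poly_delete_row:
  assumes "augmented_config m n G" "u \<in> {1..m}"
  shows "config_poly G x y = config_poly (delete_row u G) (\<lambda>i. x (skip_row u i)) y
    + (\<Sum>S\<in>{S \<in> supports G. \<exists>c\<in>S. fst c = u}. (\<Sum>c\<in>S. cell_mono c x y)\<^sup>2)"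
proof -
  let ?g = "\<lambda>S. (\<Sum>c\<in>S. cell_mono c x y)\<^sup>2"
  have "config_poly (delete_row u G) (\<lambda>i. x (skip_row u i)) y
      = (\<Sum>S\<in>supports (delete_row u G). ?g (skip_cell u ` S))"
    unfolding config_poly_eq_sum_supports[OF augmented_config_delete_row[OF assms]]
    by (subst sum.reindex[OF inj_on_subset[OF inj_skip_cell subset_UNIV]])
      (simp add: cell_mono_def skip_cell_def)
  also have "\<dots> = sum ?g (image (skip_cell u) ` supports (delete_row u G))"
    by (rule sum.reindex[symmetric, unfolded comp_def])
      (simp add: inj_on_def inj_image_eq_iff[OF inj_skip_cell])
  also have "\<dots> = sum ?g {S \<in> supports G. \<forall>c\<in>S. fst c \<noteq> u}"
    by (simp only: image_supports_delete_row)
  finally have "config_poly (delete_row u G) (\<lambda>i. x (skip_row u i)) y + sum ?g {S \<in> supports G. \<exists>c\<in>S. fst c = u}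
      = sum ?g ({S \<in> supports G. \<forall>c\<in>S. fst c \<noteq> u} \<union> {S \<in> supports G. \<exists>c\<in>S. fst c = u})"
    using supports_finite[OF assms(1)] by (subst sum.union_disjoint) auto
  also have "{S \<in> supports G. \<forall>c\<in>S. fst c \<noteq> u} \<union> {S \<in> supports G. \<exists>c\<in>S. fst c = u} = supports G"
    by auto
  finally show ?thesis using config_poly_eq_sum_supports[OF assms(1)] by simp
qed

text \<open>A representation of the smaller polynomial by \<open>r\<close> squares extends to one of
  \<open>config_poly G\<close> by \<open>r + card ?T\<close> squares, where \<open>?T\<close> is the
  family of deleted edges. Irreducibility of \<open>G\<close> bounds this number below by
  \<open>num_squares G\<close>, and cancelling \<open>card ?T\<close> bounds
  \<open>r\<close>.\<close>

lemma irreducible_config_delete_row: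
  assumes aug: "augmented_config m n G" and u: "u \<in> {1..m}" and irr: "irreducible_config m n G"
  shows "irreducible_config (m - 1) n (delete_row u G)"
  unfolding irreducible_config_def SOS_def
proof (rule Least_equality)
  show "sum_of_squares (m - 1) n (num_squares (delete_row u G)) (config_poly (delete_row u G))"
    by (intro sum_of_squares_config_poly augmented_config_delete_row aug u)
next
  fix r assume r: "sum_of_squares (m - 1) n r (config_poly (delete_row u G))"
  let ?T = "{S \<in> supports G. \<exists>c\<in>S. fst c = u}"
  have "sum_of_squares m n (card ?T) (\<lambda>x y. \<Sum>S\<in>?T. (\<Sum>c\<in>S. cell_mono c x y)\<^sup>2)"
    using supports_finite[OF aug] by (intro sum_of_squares_sum_cells) auto
  note sum_of_squares_add[OF sum_of_squares_skip_row[OF r u] this]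
  also have "(\<lambda>x y. config_poly (delete_row u G) (\<lambda>i. x (skip_row u i)) y
      + (\<Sum>S\<in>?T. (\<Sum>c\<in>S. cell_mono c x y)\<^sup>2)) = config_poly G"
    by (intro ext) (rule config_poly_delete_row[OF aug u, symmetric])
  finally have "SOS m n (config_poly G) \<le> r + card ?T"
    unfolding SOS_def by (rule Least_le)
  then have "num_squares G \<le> r + card ?T"
    using irr unfolding irreducible_config_def by simp
  then show "num_squares (delete_row u G) \<le> r"
    using num_squares_delete_row[OF aug u] by simp
qed

section \<open>One-edges alone\<close>

text \<open>Evaluates a form when all but two row variables and two column variables vanish. The
  four cells may lie outside the grid, which is why \<open>w\<close> is required to be 0
  there.\<close>

lemma sum_grid_two_rows_columns:
  assumes "i \<noteq> k" "j \<noteq> l" "\<And>c. c \<notin> grid m n \<Longrightarrow> w c = 0"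
    and w0: "\<And>r s. (r \<noteq> i \<and> r \<noteq> k) \<or> (s \<noteq> j \<and> s \<noteq> l) \<Longrightarrow> w (r, s) = 0"
  shows "(\<Sum>c\<in>grid m n. w c) = w (i, j) + w (i, l) + w (k, j) + (w (k, l) :: real)"
proof -
  let ?Q = "{(i, j), (i, l), (k, j), (k, l)}"
  have "sum w (grid m n) = sum w (grid m n \<union> ?Q)"
    by (rule sum.mono_neutral_left) (use assms(3) in auto)
  also have "\<dots> = sum w ?Q"
    by (rule sum.mono_neutral_right) (use w0 in auto)
  finally show ?thesis using assms(1,2) by simp
qed

text \<open>The vectors \<open>(a k c)\<^sub>k\<close> for the cells \<open>c\<close> of a \<open>C\<^sub>4\<close>-free set are orthonormal, as one sees by
  comparing coefficients: the monomial \<open>u\<^sub>i\<^sub>j u\<^sub>k\<^sub>l = u\<^sub>i\<^sub>l u\<^sub>k\<^sub>j\<close> is the only kind that arises from two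
  pairs of cells, and one of the cells \<open>(i, l)\<close>, \<open>(k, j)\<close> has the zero vector.\<close>

lemma gram_C4_free:
  fixes a :: "nat \<Rightarrow> cell \<Rightarrow> real"
  assumes B: "B \<subseteq> grid m n" "C4_free B"
    and a0: "\<And>k c. c \<notin> grid m n \<Longrightarrow> a k c = 0"
    and eq: "\<And>x y. (\<Sum>c\<in>B. (cell_mono c x y)\<^sup>2)
      = (\<Sum>k<r. (\<Sum>c\<in>grid m n. a k c * cell_mono c x y)\<^sup>2)"
    and cd: "c \<in> B" "d \<in> B"
  shows "(\<Sum>k<r. a k c * a k d) = of_bool (c = d)"
proof -
  define ip where "ip c d = (\<Sum>k<r. a k c * a k d)" for c d
  define b where "b c = (of_bool (c \<in> B) :: real)" for c
  \<comment> \<open>The polynomial identity restricted to two row variables with values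
    \<open>s\<close>, \<open>t\<close> and two column variables with values \<open>p\<close>,
    \<open>q\<close>, all other variables being 0.\<close>
  have expand: "s\<^sup>2*p\<^sup>2 * b (i,j) + s\<^sup>2*q\<^sup>2 * b (i,l) + t\<^sup>2*p\<^sup>2 * b (h,j) + t\<^sup>2*q\<^sup>2 * b (h,l)
      = s\<^sup>2*p\<^sup>2 * ip (i,j) (i,j) + s\<^sup>2*q\<^sup>2 * ip (i,l) (i,l)
      + t\<^sup>2*p\<^sup>2 * ip (h,j) (h,j) + t\<^sup>2*q\<^sup>2 * ip (h,l) (h,l)
      + 2*s\<^sup>2*p*q * ip (i,j) (i,l) + 2*t\<^sup>2*p*q * ip (h,j) (h,l)
      + 2*s*t*p\<^sup>2 * ip (i,j) (h,j) + 2*s*t*q\<^sup>2 * ip (i,l) (h,l)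
      + 2*s*t*p*q * (ip (i,j) (h,l) + ip (i,l) (h,j))"
    if ne: "i \<noteq> h" "j \<noteq> l" for i h j l s t p q
  proof -
    define x where "x v = (if v = i then s else if v = h then t else 0)" for v
    define y where "y v = (if v = j then p else if v = l then q else 0)" for v
    have mono: "cell_mono (i,j) x y = s*p" "cell_mono (i,l) x y = s*q"
      "cell_mono (h,j) x y = t*p" "cell_mono (h,l) x y = t*q"
      using ne by (auto simp: cell_mono_def x_def y_def)
    have zero: "cell_mono (v, w) x y = 0" if "(v \<noteq> i \<and> v \<noteq> h) \<or> (w \<noteq> j \<and> w \<noteq> l)" for v w
      using that by (auto simp: cell_mono_def x_def y_def)
    have "(\<Sum>c\<in>B. (cell_mono c x y)\<^sup>2) = (\<Sum>c\<in>grid m n. b c * (cell_mono c x y)\<^sup>2)"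
      by (rule sum.mono_neutral_cong_left) (use B(1) in \<open>auto simp: b_def\<close>)
    also have "\<dots> = b (i,j) * (s*p)\<^sup>2 + b (i,l) * (s*q)\<^sup>2 + b (h,j) * (t*p)\<^sup>2 + b (h,l) * (t*q)\<^sup>2"
      by (subst sum_grid_two_rows_columns[OF ne])
        (use B(1) zero in \<open>auto simp: b_def mono\<close>)
    finally have lhs: "(\<Sum>c\<in>B. (cell_mono c x y)\<^sup>2) = \<dots>" .
    have form: "(\<Sum>c\<in>grid m n. a k c * cell_mono c x y)
        = a k (i,j) * (s*p) + a k (i,l) * (s*q) + a k (h,j) * (t*p) + a k (h,l) * (t*q)" for k
      by (subst sum_grid_two_rows_columns[OF ne]) (use a0 zero in \<open>auto simp: mono\<close>)
    have "(\<Sum>k<r. (\<Sum>c\<in>grid m n. a k c * cell_mono c x y)\<^sup>2)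
      = s\<^sup>2*p\<^sup>2 * ip (i,j) (i,j) + s\<^sup>2*q\<^sup>2 * ip (i,l) (i,l)
      + t\<^sup>2*p\<^sup>2 * ip (h,j) (h,j) + t\<^sup>2*q\<^sup>2 * ip (h,l) (h,l)
      + 2*s\<^sup>2*p*q * ip (i,j) (i,l) + 2*t\<^sup>2*p*q * ip (h,j) (h,l)
      + 2*s*t*p\<^sup>2 * ip (i,j) (h,j) + 2*s*t*q\<^sup>2 * ip (i,l) (h,l)
      + 2*s*t*p*q * (ip (i,j) (h,l) + ip (i,l) (h,j))"
      unfolding form ip_def sum_distrib_left sum.distrib[symmetric]
      by (rule sum.cong) (simp_all add: power2_eq_square algebra_simps)
    then show ?thesis using eq[of x y] lhs by (simp add: power_mult_distrib algebra_simps)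
  qed
  \<comment> \<open>In these instances the numbers are the values of \<open>s\<close>,
    \<open>p\<close>, \<open>q\<close>, \<open>t\<close>, in order of first occurrence.
    \<open>Suc i\<close> and \<open>Suc j\<close> only supply a second row or column, whose variable
    is set to 0. Comparing the values 1 and -1 of one variable isolates a mixed coefficient.\<close>
  have norm: "ip (i, j) (i, j) = b (i, j)" for i j
    using expand[of i "Suc i" j "Suc j" 1 1 0 0] by simp
  have row: "ip (i, j) (i, l) = 0" if "j \<noteq> l" for i j l
    using expand[of i "Suc i" j l 1 1 1 0] expand[of i "Suc i" j l 1 1 "-1" 0] that by simp
  have col: "ip (i, j) (h, j) = 0" if "i \<noteq> h" for i h j
    using expand[of i h j "Suc j" 1 1 0 1] expand[of i h j "Suc j" 1 1 0 "-1"] that by simp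
  have cross: "ip (i, j) (h, l) + ip (i, l) (h, j) = 0" if "i \<noteq> h" "j \<noteq> l" for i h j l
    using expand[of i h j l 1 1 1 1] that norm row col by simp
  \<comment> \<open>A cell outside \<open>B\<close> has a coefficient vector of norm 0, so all its
    coefficients are 0.\<close>
  have vanish: "ip e f = 0" if "e \<notin> B \<or> f \<notin> B" for e f
  proof -
    have "a k e = 0" if "e \<notin> B" "k < r" for k e
    proof -
      have "ip e e = 0" using norm[of "fst e" "snd e"] that by (simp add: b_def)
      then have "(\<Sum>k<r. (a k e)\<^sup>2) = 0" by (simp add: ip_def power2_eq_square)
      then show ?thesis using that(2) sum_nonneg_eq_0_iff[of "{..<r}" "\<lambda>k. (a k e)\<^sup>2"] by simp
    qed
    then show ?thesis using that unfolding ip_def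
      by (intro sum.neutral ballI) (metis lessThan_iff mult_zero_left mult_zero_right)
  qed
  obtain i j h l where c: "c = (i, j)" and d: "d = (h, l)" by (cases c, cases d)
  have "ip c d = of_bool (c = d)"
  proof (cases "i = h \<or> j = l")
    case True
    then show ?thesis using norm row col cd by (auto simp: c d b_def)
  next
    case False
    then have "(i, l) \<notin> B \<or> (h, j) \<notin> B"
      using B(2) cd unfolding C4_free_def c d by blast
    then show ?thesis using False cross[of i h j l] vanish[of "(i, l)" "(h, j)"]
      by (simp add: c d)
  qed
  then show ?thesis by (simp add: ip_def)
qed

text \<open>Bessel's inequality for the \<open>k\<close>-th standard basis vector.\<close>

lemma card_orthonormal_le:
  fixes a :: "nat \<Rightarrow> 'a \<Rightarrow> real"
  assumes "finite B" and orth: "\<And>c d. c \<in> B \<Longrightarrow> d \<in> B \<Longrightarrow> (\<Sum>k<r. a k c * a k d) = of_bool (c = d)"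
  shows "card B \<le> r"
proof -
  have bessel: "(\<Sum>c\<in>B. (a k c)\<^sup>2) \<le> 1" if "k < r" for k
  proof -
    define s where "s = (\<Sum>c\<in>B. (a k c)\<^sup>2)"
    \<comment> \<open>\<open>v\<close> is the orthogonal projection of the \<open>k\<close>-th basis
      vector to the span of the given vectors. Both its squared norm and its \<open>k\<close>-th
      entry equal \<open>s\<close>, so \<open>s * s\<close> \<le> \<open>s\<close>.\<close>
    define v where "v l = (\<Sum>c\<in>B. a k c * a l c)" for l
    have "(\<Sum>l<r. (v l)\<^sup>2) = (\<Sum>l<r. \<Sum>c\<in>B. \<Sum>d\<in>B. (a k c * a k d) * (a l c * a l d))"
      by (simp add: v_def power2_eq_square sum_product mult_ac)
    also have "\<dots> = (\<Sum>c\<in>B. \<Sum>l<r. \<Sum>d\<in>B. (a k c * a k d) * (a l c * a l d))"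
      by (rule sum.swap)
    also have "\<dots> = (\<Sum>c\<in>B. \<Sum>d\<in>B. \<Sum>l<r. (a k c * a k d) * (a l c * a l d))"
      by (intro sum.cong refl sum.swap)
    also have "\<dots> = (\<Sum>c\<in>B. \<Sum>d\<in>B. (a k c * a k d) * of_bool (c = d))"
      by (simp add: orth flip: sum_distrib_left)
    also have "\<dots> = s"
      using assms(1) by (simp add: s_def power2_eq_square if_distrib of_bool_def cong: if_cong)
    finally have "(\<Sum>l<r. (v l)\<^sup>2) = s" .
    moreover have "(v k)\<^sup>2 \<le> (\<Sum>l<r. (v l)\<^sup>2)"
      using that by (intro member_le_sum) auto
    moreover have "v k = s" by (simp add: v_def s_def power2_eq_square)
    ultimately have "s * s \<le> s" by (simp add: power2_eq_square)
    moreover have "s \<ge> 0" unfolding s_def by (simp add: sum_nonneg)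
    ultimately show ?thesis unfolding s_def[symmetric]
      by (auto simp: mult_le_cancel_left2)
  qed
  \<comment> \<open>Each vector has norm 1, so \<open>card B\<close> is the sum of all squared
    entries; summing by coordinates instead gives at most 1 for each of the \<open>r\<close>
    coordinates.\<close>
  have "real (card B) = (\<Sum>c\<in>B. \<Sum>k<r. (a k c)\<^sup>2)"
    using orth by (simp add: power2_eq_square)
  also have "\<dots> = (\<Sum>k<r. \<Sum>c\<in>B. (a k c)\<^sup>2)" by (rule sum.swap)
  also have "\<dots> \<le> (\<Sum>k<r. 1)" by (intro sum_mono bessel) simp
  finally show ?thesis by simp
qed

text \<open>Any representation by \<open>r\<close> squares yields \<open>card B\<close> orthonormal
  vectors of length \<open>r\<close>, hence \<open>card B\<close> \<le> \<open>r\<close>. This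
  guarantees that the maximum defining \<open>z2\<close> is over a nonempty set.\<close>

lemma irreducible_config_one_edges:
  assumes B: "B \<subseteq> grid m n" "C4_free B"
  shows "irreducible_config m n (B, {})"
  unfolding irreducible_config_def SOS_def
proof (rule Least_equality)
  show "sum_of_squares m n (num_squares (B, {})) (config_poly (B, {}))"
    by (rule sum_of_squares_config_poly) (simp add: augmented_config_def B)
next
  fix r assume "sum_of_squares m n r (config_poly (B, {}))"
  then obtain f where f: "\<forall>k<r. bilinear_form m n (f k)"
    and P: "\<And>x y. config_poly (B, {}) x y = (\<Sum>k<r. (f k x y)\<^sup>2)"
    unfolding sum_of_squares_def by blast
  then obtain a where a: "\<And>k x y. k < r \<Longrightarrow> f k x y = (\<Sum>c\<in>grid m n. a k c * cell_mono c x y)"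
    unfolding bilinear_form_def by metis
  \<comment> \<open>Coefficients outside the grid do not affect the forms; setting them to 0 meets
    the requirement of \<open>gram_C4_free\<close>.\<close>
  define a' where "a' k c = (if c \<in> grid m n then a k c else 0)" for k c
  have "(\<Sum>c\<in>B. (cell_mono c x y)\<^sup>2)
      = (\<Sum>k<r. (\<Sum>c\<in>grid m n. a' k c * cell_mono c x y)\<^sup>2)" for x y
    using P[of x y] by (simp add: config_poly_def a a'_def)
  then have "card B \<le> r"
    using B finite_subset[OF B(1)]
    by (intro card_orthonormal_le[where a = a'] gram_C4_free[where a = a', OF B]) (auto simp: a'_def)
  then show "num_squares (B, {}) \<le> r" by (simp add: num_squares_def)
qed

section \<open>The value of \<open>z m 4\<close>\<close>

text \<open>Two rows sharing a pair of columns would form a four-cycle, so the sets of column pairs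
  seen by different rows are disjoint.\<close>

lemma sum_degree_choose_2_le:
  assumes "B \<subseteq> grid m n" "C4_free B"
  shows "(\<Sum>i\<in>{1..m}. card (B `` {i}) choose 2) \<le> n choose 2"
proof -
  let ?T = "\<lambda>i. {p. p \<subseteq> B `` {i} \<and> card p = 2}"
  have sub: "B `` {i} \<subseteq> {1..n}" for i using assms(1) by (auto simp: grid_def)
  have fin: "finite (B `` {i})" for i using finite_subset[OF sub] by blast
  have "?T i \<inter> ?T k = {}" if "i \<noteq> k" for i k
  proof -
    have False if p: "p \<subseteq> B `` {i}" "p \<subseteq> B `` {k}" "card p = 2" for p
    proof -
      obtain j l where "p = {j, l}" "j \<noteq> l" using p(3) by (meson card_2_iff)
      then have "(i, j) \<in> B" "(k, j) \<in> B" "(k, l) \<in> B" "(i, l) \<in> B" using p(1,2) by auto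
      then show False using \<open>i \<noteq> k\<close> \<open>j \<noteq> l\<close> assms(2) unfolding C4_free_def by metis
    qed
    then show ?thesis by blast
  qed
  moreover have "finite (?T i)" for i
    by (rule finite_subset[of _ "Pow (B `` {i})"]) (use fin in auto)
  ultimately have "card (\<Union>i\<in>{1..m}. ?T i) = (\<Sum>i\<in>{1..m}. card (?T i))"
    by (intro card_UN_disjoint) auto
  moreover have "card (\<Union>i\<in>{1..m}. ?T i) \<le> card {p. p \<subseteq> {1..n} \<and> card p = 2}"
  proof (rule card_mono)
    show "finite {p. p \<subseteq> {1..n} \<and> card p = 2}"
      by (rule finite_subset[of _ "Pow {1..n}"]) auto
  qed (use sub in blast)
  ultimately show ?thesis by (simp add: n_subsets fin)
qed

lemma card_eq_sum_degrees:
  assumes "B \<subseteq> grid m n"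
  shows "card B = (\<Sum>i\<in>{1..m}. card (B `` {i}))"
proof -
  have "B = (SIGMA i:{1..m}. B `` {i})" using assms by (auto simp: grid_def)
  moreover have "finite (B `` {i})" for i
    by (rule finite_subset[of _ "{1..n}"]) (use assms in \<open>auto simp: grid_def\<close>)
  ultimately show ?thesis by (metis card_SigmaI finite_atLeastAtMost)
qed

text \<open>Sum the inequality \<open>d\<close> \<le> \<open>(d choose 2) + 1\<close> over the row
  degrees and apply the bound on column pairs.\<close>

lemma card_C4_free_le:
  assumes "B \<subseteq> grid m n" "C4_free B"
  shows "card B \<le> m + (n choose 2)"
proof -
  have "d \<le> (d choose 2) + 1" for d :: nat
    by (induction d) (auto simp: numeral_2_eq_2)
  then have "card B \<le> (\<Sum>i\<in>{1..m}. (card (B `` {i}) choose 2) + 1)"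
    unfolding card_eq_sum_degrees[OF assms(1)] by (intro sum_mono)
  also have "\<dots> \<le> m + (n choose 2)"
    using sum_degree_choose_2_le[OF assms] by (simp only: sum.distrib) simp
  finally show ?thesis .
qed

text \<open>Every degree other than 1, including 0, satisfies \<open>d\<close> \<le>
  \<open>2 * (d choose 2)\<close>. Without a row of degree one, summation would give at most
  \<open>2 * (n choose 2)\<close> cells.\<close>

lemma ex_degree_one_row:
  assumes "B \<subseteq> grid m n" "C4_free B" "card B > 2 * (n choose 2)"
  shows "\<exists>u\<in>{1..m}. card (B \<inter> row_cells n u) = 1"
proof (rule ccontr)
  assume none: "\<not> ?thesis"
  have "card (B \<inter> row_cells n i) = card (B `` {i})" for i
  proof -
    have "B \<inter> row_cells n i = Pair i ` (B `` {i})"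
      using assms(1) by (auto simp: row_cells_def grid_def)
    then show ?thesis by (simp add: card_image inj_on_def)
  qed
  then have ne: "card (B `` {i}) \<noteq> 1" if "i \<in> {1..m}" for i
    using none that by auto
  have "d \<le> 2 * (d choose 2)" if "d \<noteq> 1" for d :: nat
    using that by (cases d) (auto simp: choose_two)
  then have "card B \<le> (\<Sum>i\<in>{1..m}. 2 * (card (B `` {i}) choose 2))"
    unfolding card_eq_sum_degrees[OF assms(1)] by (intro sum_mono) (use ne in blast)
  also have "\<dots> \<le> 2 * (n choose 2)"
    using sum_degree_choose_2_le[OF assms(1,2)] by (simp flip: sum_distrib_left)
  finally show False using assms(3) by simp
qed

lemma finite_z_set: "finite {card B |B. B \<subseteq> grid m n \<and> C4_free B}"
  by (rule finite_subset[of _ "card ` Pow (grid m n)"]) auto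

lemma z_attained: "\<exists>B. B \<subseteq> grid m n \<and> C4_free B \<and> card B = z m n"
proof -
  have "C4_free {}" by (simp add: C4_free_def)
  then have "{card B |B. B \<subseteq> grid m n \<and> C4_free B} \<noteq> {}" by blast
  from Max_in[OF finite_z_set this]
  have "z m n \<in> {card B |B. B \<subseteq> grid m n \<and> C4_free B}" unfolding z_def .
  then show ?thesis unfolding mem_Collect_eq by metis
qed

text \<open>In the extremal example the first six rows are the six pairs of columns; the product
  \<open>j * l\<close> determines the pair.\<close>

lemma z_4:
  assumes "m \<ge> 6"
  shows "z m 4 = m + 6"
proof (rule antisym)
  have "(4 choose 2 :: nat) = 6" by (simp add: choose_two)
  then show "z m 4 \<le> m + 6"
    using z_attained[of m 4] card_C4_free_le[of _ m 4] by metis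
next
  define N :: "nat \<Rightarrow> nat set" where
    "N i = (if i = 1 then {1,2} else if i = 2 then {1,3} else if i = 3 then {1,4}
      else if i = 4 then {2,3} else if i = 5 then {2,4} else if i = 6 then {3,4} else {1})" for i
  define B where "B = (SIGMA i:{1..m}. N i)"
  have sub: "B \<subseteq> grid m 4"
    by (auto simp: B_def N_def grid_def split: if_splits)
  have free: "C4_free B"
  proof -
    have pair: "(i, j * l) \<in> {(1,2),(2,3),(3,4),(4,6),(5,8),(6,12)}"
      if "j \<in> N i" "l \<in> N i" "j \<noteq> l" for i j l
      using that by (auto simp: N_def split: if_splits)
    have "i = k" if "j \<in> N i" "l \<in> N i" "j \<in> N k" "l \<in> N k" "j \<noteq> l" for i j k l
      using pair[OF that(1,2,5)] pair[OF that(3,4,5)] by auto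
    then show ?thesis unfolding C4_free_def B_def by blast
  qed
  have card: "card B = m + 6"
  proof -
    let ?I = "{1,2,3,4,5,6} :: nat set"
    have I: "?I \<subseteq> {1..m}" using assms by auto
    have fin: "finite (N i)" for i
      unfolding N_def by (simp split: if_split)
    have "card {j, l :: nat} = 2" if "j \<noteq> l" for j l
      using that by simp
    then have "card (N i) = (if i \<in> ?I then 2 else 1)" for i
      unfolding N_def by simp
    then have "card B = (\<Sum>i\<in>{1..m}. if i \<in> ?I then 2 else 1)"
      unfolding B_def by (subst card_SigmaI) (simp_all only: fin finite_atLeastAtMost ball_triv simp_thms)
    also have "\<dots> = (\<Sum>i\<in>{1..m} - ?I. 1) + (\<Sum>i\<in>?I. 2)"
      by (subst sum.subset_diff[OF I]) (auto intro!: arg_cong2[of _ _ _ _ "(+)"] sum.cong)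
    also have "\<dots> = m + 6"
      using I assms by (simp add: card_Diff_subset)
    finally show ?thesis .
  qed
  have "m + 6 \<in> {card B |B. B \<subseteq> grid m 4 \<and> C4_free B}"
    using sub free card by (metis (mono_tags, lifting) mem_Collect_eq)
  then show "m + 6 \<le> z m 4"
    unfolding z_def by (rule Max_ge[OF finite_z_set])
qed

section \<open>The recursion for \<open>z2\<close>\<close>

lemma finite_z2_set:
  "finite {num_squares G |G. limited_config m n G \<and> irreducible_config m n G}"
proof (rule finite_subset)
  show "{num_squares G |G. limited_config m n G \<and> irreducible_config m n G}
      \<subseteq> num_squares ` (Pow (grid m n) \<times> Pow (Pow (grid m n)))"
    by (force simp: limited_config_def augmented_config_def mem_Times_iff)
qed simp

lemma z2_ge:
  "limited_config m n G \<Longrightarrow> irreducible_config m n G \<Longrightarrow> num_squares G \<le> z2 m n"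
  unfolding z2_def by (rule Max_ge[OF finite_z2_set]) blast

text \<open>An extremal set of one-edges with no two-edges is limited and irreducible, so the finite
  set of values is nonempty and contains its maximum.\<close>

lemma z2_attained:
  "\<exists>G. limited_config m n G \<and> irreducible_config m n G \<and> num_squares G = z2 m n"
proof -
  obtain B where B: "B \<subseteq> grid m n" "C4_free B" "card B = z m n"
    using z_attained by blast
  then have "limited_config m n (B, {})"
    by (auto simp: limited_config_def augmented_config_def simple_config_def supports_def
        pairwise_def)
  with irreducible_config_one_edges[OF B(1,2)]
  have "{num_squares G |G. limited_config m n G \<and> irreducible_config m n G} \<noteq> {}" by blast
  from Max_in[OF finite_z2_set this]
  have "z2 m n \<in> {num_squares G |G. limited_config m n G \<and> irreducible_config m n G}"
    unfolding z2_def .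
  then show ?thesis unfolding mem_Collect_eq by metis
qed

text \<open>Deleting the row costs exactly one one-edge, and the assumption on \<open>z\<close> says
  that this is what keeps the configuration limited. The bound is additive to avoid truncated
  subtraction.\<close>

lemma num_squares_le_z2_delete_row:
  assumes lim: "limited_config m n G" and irr: "irreducible_config m n G"
    and u: "degree_one_row m n G u" and z: "z m n = Suc (z (m - 1) n)"
  shows "num_squares G + row_holes n G u + row_two_edges n G u \<le> z2 (m - 1) n + n"
proof -
  have aug: "augmented_config m n G" and simple: "simple_config G"
    and sub: "one_edges G \<subseteq> grid m n"
    using lim by (auto simp: limited_config_def augmented_config_def)
  have um: "u \<in> {1..m}" using u by (simp add: degree_one_row_def)
  have "limited_config (m - 1) n (delete_row u G)"
    using lim u z card_one_edges_delete_row[OF sub, of u] augmented_config_delete_row[OF aug um]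
    by (simp add: limited_config_def degree_one_row_def C4_free_delete_row
        simple_config_delete_row)
  from z2_ge[OF this irreducible_config_delete_row[OF aug um irr]]
  have "num_squares (delete_row u G) \<le> z2 (m - 1) n" .
  then show ?thesis
    using num_squares_delete_row[OF aug um] card_edges_meeting_row[OF aug simple um] by linarith
qed

theorem proposition4p5:
  fixes m :: nat
  assumes "m \<ge> 7"
  shows "(\<forall>G u. limited_config m 4 G \<and> irreducible_config m 4 G \<and> degree_one_row m 4 G u \<longrightarrow>
            int (num_squares G) - 4 + int (row_holes 4 G u) + int (row_two_edges 4 G u)
              \<le> int (z2 (m - 1) 4))
         \<and> z2 m 4 \<le> z2 (m - 1) 4 + 4"
proof -
  \<comment> \<open>Here \<open>m\<close> \<ge> 7 is needed: \<open>z_4\<close> must apply to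
    \<open>m - 1\<close> as well.\<close>
  have z: "z m 4 = Suc (z (m - 1) 4)" using assms by (simp add: z_4)
  note bound = num_squares_le_z2_delete_row[OF _ _ _ z]
  obtain G where G: "limited_config m 4 G" "irreducible_config m 4 G" "num_squares G = z2 m 4"
    using z2_attained by blast
  \<comment> \<open>There are \<open>m + 6\<close> \<ge> 13 one-edges against the threshold 12, so a
    maximal configuration has a degree-one row to delete.\<close>
  have "card (one_edges G) > 2 * (4 choose 2)"
    using G(1) assms by (simp add: limited_config_def z_4 choose_two)
  then obtain u where "degree_one_row m 4 G u"
    using ex_degree_one_row[of "one_edges G" m 4] G(1)
    by (auto simp: limited_config_def augmented_config_def degree_one_row_def)
  from bound[OF G(1,2) this] have "z2 m 4 \<le> z2 (m - 1) 4 + 4" using G(3) by simp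
  moreover have "int (num_squares G) - 4 + int (row_holes 4 G u) + int (row_two_edges 4 G u)
      \<le> int (z2 (m - 1) 4)"
    if "limited_config m 4 G" "irreducible_config m 4 G" "degree_one_row m 4 G u" for G u
    using bound[OF that] by linarith
  ultimately show ?thesis by blast
qed

end
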